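(* Let $n\geq 2$ and let $N\subseteq \mathbb{H}^n$ be a net in the real hyperbolic $n$-space. Then the Lipschitz-free space $\mathcal{F}(N)$, where $N$ carries the metric inherited from $\mathbb{H}^n$, has a Schauder basis.
   Context: For $x,y\in\mathbb{R}^{n+1}$ put $\langle x,y\rangle=\sum_{i=1}^n x_iy_i-x_{n+1}y_{n+1}$. The real hyperbolic $n$-space is $\mathbb{H}^n=\{x\in\mathbb{R}^{n+1}: \langle x,x\rangle=-1,\ x_{n+1}>0\}$ with the metric $d$ determined by $\cosh d(x,y)=-\langle x,y\rangle$. A subset $N$ of a metric space $(X,d)$ is a net if there are constants $a,b>0$ such that $d(x,y)\geq a$ for all distinct $x,y\in N$, and every point of $X$ is at distance at most $b$ from some point of $N$. For a metric space $M$ with a distinguished point $0\in M$, $\mathrm{Lip}_0(M)$ is the Banach space of real-valued Lipschitz functions on $M$ vanishing at $0$, normed by the minimal Lipschitz constant. The Lipschitz-free space $\mathcal{F}(M)$ is the closed linear span of $\{\delta(x):x\in M\}$ in $\mathrm{Lip}_0(M)^*$, where $\delta(x)(f)=f(x)$ (up to linear isometry it does not depend on the choice of $0$). *)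

theory Defs
  imports "HOL-Analysis.Analysis"
begin

section \<open>Real hyperbolic space\<close>

text \<open>
  The space R^(n+1) is modelled as \<open>(real^'n) \<times> real\<close> with \<open>n = CARD('n)\<close>; the second
  component is the last coordinate.
\<close>

definition minkowski :: "(real^'n) \<times> real \<Rightarrow> (real^'n) \<times> real \<Rightarrow> real" where
  "minkowski x y = (\<Sum>i\<in>UNIV. fst x $ i * fst y $ i) - snd x * snd y"

definition hyperbolic_space :: "((real^'n) \<times> real) set" where
  "hyperbolic_space = {x. minkowski x x = -1 \<and> snd x > 0}"

definition hyperbolic_dist :: "(real^'n) \<times> real \<Rightarrow> (real^'n) \<times> real \<Rightarrow> real" where
  "hyperbolic_dist x y = arcosh (- minkowski x y)"

lemma minkowski_inner: "minkowski x y = fst x \<bullet> fst y - snd x * snd y"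
  by (simp add: minkowski_def inner_vec_def)

lemma minkowski_commute: "minkowski x y = minkowski y x"
  by (simp add: minkowski_inner inner_commute)

lemma minkowski_diff_scaleR:
  "minkowski (x - r *\<^sub>R y) z = minkowski x z - r * minkowski y z"
  "minkowski z (x - r *\<^sub>R y) = minkowski z x - r * minkowski z y"
  by (simp_all add: minkowski_inner algebra_simps)

lemma minkowski_le_minus1:
  assumes "x \<in> hyperbolic_space" "y \<in> hyperbolic_space"
  shows "1 \<le> - minkowski x y"
proof -
  obtain u s where x: "x = (u, s)" by (cases x)
  obtain v t where y: "y = (v, t)" by (cases y)
  have s: "s > 0" "s\<^sup>2 = 1 + (norm u)\<^sup>2" and t: "t > 0" "t\<^sup>2 = 1 + (norm v)\<^sup>2"
    using assms
    by (auto simp: x y hyperbolic_space_def minkowski_inner power2_eq_square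
        dot_square_norm simp flip: power2_norm_eq_inner)
  have "(1 + norm u * norm v)\<^sup>2 \<le> (s * t)\<^sup>2"
  proof -
    have "(s * t)\<^sup>2 - (1 + norm u * norm v)\<^sup>2 = (norm u - norm v)\<^sup>2"
      unfolding power_mult_distrib s t by (simp add: power2_eq_square algebra_simps)
    then show ?thesis using zero_le_power2[of "norm u - norm v"] by linarith
  qed
  then have "1 + norm u * norm v \<le> s * t"
    by (rule power2_le_imp_le) (use s t in simp)
  then show ?thesis
    using norm_cauchy_schwarz[of u v] by (simp add: x y minkowski_inner)
qed

lemma cosh_hyperbolic_dist:
  assumes "x \<in> hyperbolic_space" "y \<in> hyperbolic_space"
  shows "cosh (hyperbolic_dist x y) = - minkowski x y"
  using minkowski_le_minus1[OF assms] by (simp add: hyperbolic_dist_def)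

lemma minkowski_orthogonal:
  assumes y: "y \<in> hyperbolic_space" and w: "minkowski w y = 0"
  shows "0 \<le> minkowski w w" "minkowski w w = 0 \<Longrightarrow> w = 0"
proof -
  obtain a r where w': "w = (a, r)" by (cases w)
  obtain v t where y': "y = (v, t)" by (cases y)
  have t: "t > 0" "t\<^sup>2 = 1 + (norm v)\<^sup>2"
    using y
    by (auto simp: y' hyperbolic_space_def minkowski_inner power2_eq_square
        dot_square_norm simp flip: power2_norm_eq_inner)
  have "a \<bullet> v = r * t" using w by (simp add: w' y' minkowski_inner)
  then have "(r * t)\<^sup>2 \<le> (norm a)\<^sup>2 * (norm v)\<^sup>2"
    using Cauchy_Schwarz_ineq[of a v] by (simp add: power2_norm_eq_inner)
  then have le: "r\<^sup>2 + r\<^sup>2 * (norm v)\<^sup>2 \<le> (norm a)\<^sup>2 * (norm v)\<^sup>2"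
    by (simp add: power_mult_distrib t algebra_simps)
  have m: "minkowski w w = (norm a)\<^sup>2 - r\<^sup>2"
    by (simp add: w' minkowski_inner power2_norm_eq_inner) (simp add: power2_eq_square)
  show "0 \<le> minkowski w w"
  proof (rule ccontr)
    assume "\<not> 0 \<le> minkowski w w"
    then have "(norm a)\<^sup>2 * (norm v)\<^sup>2 \<le> r\<^sup>2 * (norm v)\<^sup>2" and "(norm a)\<^sup>2 < r\<^sup>2"
      using m by (auto intro!: mult_right_mono)
    then show False using le zero_le_power2[of "norm a"] by linarith
  qed
  show "w = 0" if "minkowski w w = 0"
  proof -
    have eq: "(norm a)\<^sup>2 = r\<^sup>2" using that m by simp
    then have "r\<^sup>2 \<le> 0" using le by simp
    then have "r = 0" by simp
    with eq show "w = 0" by (simp add: w' zero_prod_def)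
  qed
qed

lemma minkowski_Cauchy_Schwarz:
  assumes y: "y \<in> hyperbolic_space" and v: "minkowski v y = 0" and w: "minkowski w y = 0"
  shows "(minkowski v w)\<^sup>2 \<le> minkowski v v * minkowski w w"
proof (cases "minkowski w w = 0")
  case True
  then have "w = 0" using minkowski_orthogonal(2)[OF y w] by simp
  then show ?thesis by (simp add: minkowski_inner)
next
  case False
  let ?B = "minkowski v w" and ?W = "minkowski w w"
  have pos: "0 < ?W" using False minkowski_orthogonal(1)[OF y w] by simp
  have "minkowski (v - (?B / ?W) *\<^sub>R w) y = 0"
    by (simp add: minkowski_diff_scaleR v w)
  from minkowski_orthogonal(1)[OF y this]
  have "0 \<le> minkowski v v - ?B\<^sup>2 / ?W"
    using pos by (simp add: minkowski_diff_scaleR minkowski_commute[of w v] field_simps power2_eq_square)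
  then show ?thesis using pos by (simp add: field_simps)
qed

lemma hyperbolic_dist_commute: "hyperbolic_dist x y = hyperbolic_dist y x"
  by (simp add: hyperbolic_dist_def minkowski_commute)

lemma hyperbolic_dist_nonneg:
  assumes "x \<in> hyperbolic_space" "y \<in> hyperbolic_space"
  shows "0 \<le> hyperbolic_dist x y"
  using minkowski_le_minus1[OF assms] by (simp add: hyperbolic_dist_def)

lemma hyperbolic_dist_eq_0_iff:
  assumes x: "x \<in> hyperbolic_space" and y: "y \<in> hyperbolic_space"
  shows "hyperbolic_dist x y = 0 \<longleftrightarrow> x = y"
proof
  have n: "minkowski x x = -1" "minkowski y y = -1"
    using x y by (auto simp: hyperbolic_space_def)
  show "hyperbolic_dist x y = 0" if "x = y"
    using that n by (simp add: hyperbolic_dist_def)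
  assume "hyperbolic_dist x y = 0"
  then have e: "minkowski x y = -1" using cosh_hyperbolic_dist[OF x y] by simp
  have "minkowski (x - 1 *\<^sub>R y) y = 0" "minkowski (x - 1 *\<^sub>R y) (x - 1 *\<^sub>R y) = 0"
    unfolding minkowski_diff_scaleR by (simp_all add: n e minkowski_commute[of y x])
  then have "x - 1 *\<^sub>R y = 0" using minkowski_orthogonal(2)[OF y] by blast
  then show "x = y" by simp
qed

lemma hyperbolic_dist_triangle:
  assumes x: "x \<in> hyperbolic_space" and y: "y \<in> hyperbolic_space" and z: "z \<in> hyperbolic_space"
  shows "hyperbolic_dist x z \<le> hyperbolic_dist x y + hyperbolic_dist y z"
proof -
  let ?a = "hyperbolic_dist x y" and ?b = "hyperbolic_dist y z"
  have n: "minkowski x x = -1" "minkowski y y = -1" "minkowski z z = -1"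
    using x y z by (auto simp: hyperbolic_space_def)
  have a: "0 \<le> ?a" "minkowski x y = - cosh ?a" and b: "0 \<le> ?b" "minkowski y z = - cosh ?b"
    using cosh_hyperbolic_dist[OF x y] cosh_hyperbolic_dist[OF y z]
      hyperbolic_dist_nonneg[OF x y] hyperbolic_dist_nonneg[OF y z] by auto
  define v where "v = x - cosh ?a *\<^sub>R y"
  define w where "w = z - cosh ?b *\<^sub>R y"
  have v: "minkowski v y = 0" and w: "minkowski w y = 0"
    by (simp_all add: v_def w_def minkowski_diff_scaleR n a(2) b(2) minkowski_commute[of z y])
  have vv: "minkowski v v = (sinh ?a)\<^sup>2" and ww: "minkowski w w = (sinh ?b)\<^sup>2"
    unfolding sinh_square_eq
    by (simp_all add: v_def w_def minkowski_diff_scaleR n a(2) b(2) minkowski_commute[of z y]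
        minkowski_commute[of y x] power2_eq_square)
  have vw: "minkowski v w = minkowski x z + cosh ?a * cosh ?b"
    by (simp add: v_def w_def minkowski_diff_scaleR n a(2) b(2) minkowski_commute[of z y]
        minkowski_commute[of y x])
  have "(minkowski v w)\<^sup>2 \<le> (sinh ?a * sinh ?b)\<^sup>2"
    using minkowski_Cauchy_Schwarz[OF y v w] by (simp add: vv ww power_mult_distrib)
  then have "- minkowski v w \<le> \<bar>sinh ?a * sinh ?b\<bar>"
    unfolding abs_le_square_iff[symmetric] by linarith
  then have "- minkowski v w \<le> sinh ?a * sinh ?b"
    using a(1) b(1) by (simp add: abs_mult)
  then have "- minkowski x z \<le> cosh (?a + ?b)"
    unfolding vw cosh_add by linarith
  then have "cosh (hyperbolic_dist x z) \<le> cosh (?a + ?b)"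
    by (simp add: cosh_hyperbolic_dist[OF x z])
  then show ?thesis
    using cosh_real_nonneg_le_iff[of "hyperbolic_dist x z" "?a + ?b"]
      hyperbolic_dist_nonneg[OF x z] a(1) b(1) by linarith
qed


section \<open>Nets\<close>

definition is_net :: "'a set \<Rightarrow> ('a \<Rightarrow> 'a \<Rightarrow> real) \<Rightarrow> 'a set \<Rightarrow> bool" where
  "is_net X d N \<longleftrightarrow> N \<subseteq> X \<and>
     (\<exists>a>0. \<exists>b>0. (\<forall>x\<in>N. \<forall>y\<in>N. x \<noteq> y \<longrightarrow> a \<le> d x y) \<and>
                   (\<forall>x\<in>X. \<exists>y\<in>N. d x y \<le> b))"


section \<open>Lipschitz-free spaces\<close>

text \<open>
  \<open>M\<close> is the underlying set of a metric space with metric \<open>d\<close> and \<open>z \<in> M\<close> is its distinguished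
  point. A function on \<open>M\<close> is represented by the total function extending it by \<open>0\<close>, and likewise
  a functional on \<open>Lip\<^sub>0(M)\<close>; all vector space operations are pointwise.
\<close>

definition Lip0 :: "'a set \<Rightarrow> ('a \<Rightarrow> 'a \<Rightarrow> real) \<Rightarrow> 'a \<Rightarrow> ('a \<Rightarrow> real) set" where
  "Lip0 M d z = {f. f z = 0 \<and> (\<forall>x. x \<notin> M \<longrightarrow> f x = 0) \<and>
                    (\<exists>C\<ge>0. \<forall>x\<in>M. \<forall>y\<in>M. \<bar>f x - f y\<bar> \<le> C * d x y)}"

definition Lip_norm :: "'a set \<Rightarrow> ('a \<Rightarrow> 'a \<Rightarrow> real) \<Rightarrow> ('a \<Rightarrow> real) \<Rightarrow> real" where
  "Lip_norm M d f = Inf {C. 0 \<le> C \<and> (\<forall>x\<in>M. \<forall>y\<in>M. \<bar>f x - f y\<bar> \<le> C * d x y)}"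

definition Lip0_dual :: "'a set \<Rightarrow> ('a \<Rightarrow> 'a \<Rightarrow> real) \<Rightarrow> 'a \<Rightarrow> (('a \<Rightarrow> real) \<Rightarrow> real) set" where
  "Lip0_dual M d z = {\<phi>.
     (\<forall>f\<in>Lip0 M d z. \<forall>g\<in>Lip0 M d z. \<phi> (\<lambda>x. f x + g x) = \<phi> f + \<phi> g) \<and>
     (\<forall>c. \<forall>f\<in>Lip0 M d z. \<phi> (\<lambda>x. c * f x) = c * \<phi> f) \<and>
     (\<exists>B. \<forall>f\<in>Lip0 M d z. \<bar>\<phi> f\<bar> \<le> B * Lip_norm M d f) \<and>
     (\<forall>f. f \<notin> Lip0 M d z \<longrightarrow> \<phi> f = 0)}"

definition Lip0_dual_norm ::
    "'a set \<Rightarrow> ('a \<Rightarrow> 'a \<Rightarrow> real) \<Rightarrow> 'a \<Rightarrow> (('a \<Rightarrow> real) \<Rightarrow> real) \<Rightarrow> real" where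
  "Lip0_dual_norm M d z \<phi> = (SUP f\<in>{f \<in> Lip0 M d z. Lip_norm M d f \<le> 1}. \<bar>\<phi> f\<bar>)"

definition evaluation ::
    "'a set \<Rightarrow> ('a \<Rightarrow> 'a \<Rightarrow> real) \<Rightarrow> 'a \<Rightarrow> 'a \<Rightarrow> ('a \<Rightarrow> real) \<Rightarrow> real" where
  "evaluation M d z x = (\<lambda>f. if f \<in> Lip0 M d z then f x else 0)"

definition evaluation_span ::
    "'a set \<Rightarrow> ('a \<Rightarrow> 'a \<Rightarrow> real) \<Rightarrow> 'a \<Rightarrow> (('a \<Rightarrow> real) \<Rightarrow> real) set" where
  "evaluation_span M d z =
     {(\<lambda>f. \<Sum>x\<in>S. c x * evaluation M d z x f) | c S. finite S \<and> S \<subseteq> M}"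

text \<open>The Lipschitz-free space; its norm is \<^const>\<open>Lip0_dual_norm\<close>.\<close>

definition free_space ::
    "'a set \<Rightarrow> ('a \<Rightarrow> 'a \<Rightarrow> real) \<Rightarrow> 'a \<Rightarrow> (('a \<Rightarrow> real) \<Rightarrow> real) set" where
  "free_space M d z = {\<phi> \<in> Lip0_dual M d z.
     \<forall>\<epsilon>>0. \<exists>\<psi>\<in>evaluation_span M d z. Lip0_dual_norm M d z (\<lambda>f. \<phi> f - \<psi> f) < \<epsilon>}"


section \<open>Schauder bases\<close>

text \<open>For a real vector space \<open>F\<close> of functions under pointwise operations, with norm \<open>nrm\<close>.\<close>

definition schauder_basis ::
    "('b \<Rightarrow> real) set \<Rightarrow> (('b \<Rightarrow> real) \<Rightarrow> real) \<Rightarrow> (nat \<Rightarrow> 'b \<Rightarrow> real) \<Rightarrow> bool" where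
  "schauder_basis F nrm e \<longleftrightarrow> (\<forall>k. e k \<in> F) \<and>
     (\<forall>\<phi>\<in>F. \<exists>!a :: nat \<Rightarrow> real.
        (\<lambda>m. nrm (\<lambda>t. \<phi> t - (\<Sum>k<m. a k * e k t))) \<longlonglongrightarrow> 0)"

end

theory Submission
  imports Defs
begin

text \<open>Order the net by distance to the base point \<open>z\<close>, and let the parent of a point be a net point
  close to the geodesic towards \<open>z\<close>, a fixed large distance back. Sending each point to its first
  ancestor among the first \<open>n\<close> points gives commuting retractions with finite range, and
  hyperbolicity (geodesics to \<open>z\<close> from nearby points stay close) makes them uniformly Lipschitz. The
  differences of \<open>\<delta>\<close> at a point and at its parent are then a basis whose partial sum projections
  are induced by the retractions.\<close>

section \<open>Bases from tree retractions\<close>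

text \<open>Hyperbolicity compares distances only up to an additive error, while a chain of
  ancestors can be arbitrarily long, so the danger is that errors accumulate. A step that lowers the
  distance to \<open>z\<close> by at least the constant \<open>D\<close> of the four-point condition
  pays for its own error, and the total stays below \<open>2 * b + D\<close> whatever the length;
  this is what the fixed large distance is for. Ordering by distance to \<open>z\<close> also
  ensures that all points moved by one retraction land in a shell of bounded thickness, so nearby
  points end at comparable heights. The outcome is an estimate with an additive constant, which the
  separation of the net turns into a Lipschitz bound. As each retraction has one more point in its
  range than the one before, the induced projections gain one dimension at a time.\<close>

lemma Lip0_abs_le:
  assumes "f \<in> Lip0 M d z" and "x \<in> M" "y \<in> M" and nonneg: "0 \<le> d x y"
  shows "\<bar>f x - f y\<bar> \<le> Lip_norm M d f * d x y"
proof (cases "d x y = 0")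
  \<comment> \<open>No quotient by \<open>d x y\<close> is available here, but any admissible
    constant forces \<open>f x = f y\<close>.\<close>
  case True
  then show ?thesis using assms by (auto simp: Lip0_def) fastforce
next
  case False
  then have pos: "0 < d x y" using nonneg by simp
  let ?S = "{C. 0 \<le> C \<and> (\<forall>x\<in>M. \<forall>y\<in>M. \<bar>f x - f y\<bar> \<le> C * d x y)}"
  have "?S \<noteq> {}" using assms(1) by (auto simp: Lip0_def)
  then have "\<bar>f x - f y\<bar> / d x y \<le> Inf ?S"
    by (rule cInf_greatest) (use assms pos in \<open>auto simp: field_simps\<close>)
  then show ?thesis using pos by (simp add: Lip_norm_def field_simps)
qed

lemma Lip_norm_le:
  assumes "0 \<le> C" and "\<And>x y. x \<in> M \<Longrightarrow> y \<in> M \<Longrightarrow> \<bar>f x - f y\<bar> \<le> C * d x y"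
  shows "Lip_norm M d f \<le> C"
  unfolding Lip_norm_def by (rule cInf_lower) (use assms in \<open>auto intro!: bdd_belowI[of _ 0]\<close>)

lemma Lip_norm_nonneg:
  assumes "f \<in> Lip0 M d z" shows "0 \<le> Lip_norm M d f"
  unfolding Lip_norm_def by (rule cInf_greatest) (use assms in \<open>auto simp: Lip0_def\<close>)

lemma Lip_norm_zero: "Lip_norm M d (\<lambda>x. 0) \<le> 0"
  by (rule Lip_norm_le) auto

lemma Lip0I:
  assumes "f z = 0" "\<And>x. x \<notin> M \<Longrightarrow> f x = 0" "0 \<le> C"
    and "\<And>x y. x \<in> M \<Longrightarrow> y \<in> M \<Longrightarrow> \<bar>f x - f y\<bar> \<le> C * d x y"
  shows "f \<in> Lip0 M d z"
  using assms by (auto simp: Lip0_def)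

lemma Lip0_zero: "(\<lambda>x. 0) \<in> Lip0 M d z"
  by (auto simp: Lip0_def intro!: exI[of _ 0])

lemma Lip0_add:
  assumes "f \<in> Lip0 M d z" "g \<in> Lip0 M d z"
  shows "(\<lambda>x. f x + g x) \<in> Lip0 M d z"
proof -
  obtain C where C: "0 \<le> C" "\<And>x y. x \<in> M \<Longrightarrow> y \<in> M \<Longrightarrow> \<bar>f x - f y\<bar> \<le> C * d x y"
    using assms(1) by (auto simp: Lip0_def)
  obtain E where E: "0 \<le> E" "\<And>x y. x \<in> M \<Longrightarrow> y \<in> M \<Longrightarrow> \<bar>g x - g y\<bar> \<le> E * d x y"
    using assms(2) by (auto simp: Lip0_def)
  show ?thesis
  proof (rule Lip0I[where C = "C + E"])
    show "\<bar>f x + g x - (f y + g y)\<bar> \<le> (C + E) * d x y" if "x \<in> M" "y \<in> M" for x y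
      using C(2)[OF that] E(2)[OF that] by (simp add: distrib_right)
  qed (use assms C E in \<open>auto simp: Lip0_def\<close>)
qed

lemma Lip0_cmult:
  assumes "f \<in> Lip0 M d z"
  shows "(\<lambda>x. c * f x) \<in> Lip0 M d z"
proof -
  obtain C where C: "0 \<le> C" "\<And>x y. x \<in> M \<Longrightarrow> y \<in> M \<Longrightarrow> \<bar>f x - f y\<bar> \<le> C * d x y"
    using assms(1) by (auto simp: Lip0_def)
  show ?thesis
  proof (rule Lip0I[where C = "\<bar>c\<bar> * C"])
    show "\<bar>c * f x - c * f y\<bar> \<le> \<bar>c\<bar> * C * d x y" if "x \<in> M" "y \<in> M" for x y
      using mult_left_mono[OF C(2)[OF that], of "\<bar>c\<bar>"]
      by (simp add: abs_mult mult.assoc flip: right_diff_distrib)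
  qed (use assms C in \<open>auto simp: Lip0_def\<close>)
qed

lemma Lip0_sum:
  assumes "\<And>k. k \<in> A \<Longrightarrow> f k \<in> Lip0 M d z"
  shows "(\<lambda>x. \<Sum>k\<in>A. c k * f k x) \<in> Lip0 M d z"
  using assms
  by (induction A rule: infinite_finite_induct) (auto simp: Lip0_zero Lip0_add Lip0_cmult)

section \<open>Bounded functionals on \<open>Lip0\<close> and their norm\<close>

lemma Lip0_dualI:
  assumes "\<And>f g. f \<in> Lip0 M d z \<Longrightarrow> g \<in> Lip0 M d z \<Longrightarrow> \<phi> (\<lambda>x. f x + g x) = \<phi> f + \<phi> g"
    and "\<And>c f. f \<in> Lip0 M d z \<Longrightarrow> \<phi> (\<lambda>x. c * f x) = c * \<phi> f"
    and "\<And>f. f \<in> Lip0 M d z \<Longrightarrow> \<bar>\<phi> f\<bar> \<le> B * Lip_norm M d f"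
    and "\<And>f. f \<notin> Lip0 M d z \<Longrightarrow> \<phi> f = 0"
  shows "\<phi> \<in> Lip0_dual M d z"
  using assms unfolding Lip0_dual_def by blast

lemma Lip0_dual_zero: "(\<lambda>f. 0) \<in> Lip0_dual M d z"
  by (auto simp: Lip0_dual_def intro!: exI[of _ 0])

lemma Lip0_dual_add:
  assumes "\<phi> \<in> Lip0_dual M d z" "\<psi> \<in> Lip0_dual M d z"
  shows "(\<lambda>f. \<phi> f + \<psi> f) \<in> Lip0_dual M d z"
proof -
  obtain B E where "\<forall>f\<in>Lip0 M d z. \<bar>\<phi> f\<bar> \<le> B * Lip_norm M d f"
      "\<forall>f\<in>Lip0 M d z. \<bar>\<psi> f\<bar> \<le> E * Lip_norm M d f"
    using assms unfolding Lip0_dual_def by blast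
  then have "\<forall>f\<in>Lip0 M d z. \<bar>\<phi> f + \<psi> f\<bar> \<le> (B + E) * Lip_norm M d f"
    by (smt (verit, best) distrib_right)
  then show ?thesis
    using assms by (intro Lip0_dualI[where B = "B + E"]) (auto simp: Lip0_dual_def algebra_simps)
qed

lemma Lip0_dual_cmult:
  assumes "\<phi> \<in> Lip0_dual M d z"
  shows "(\<lambda>f. c * \<phi> f) \<in> Lip0_dual M d z"
proof -
  obtain B where "\<forall>f\<in>Lip0 M d z. \<bar>\<phi> f\<bar> \<le> B * Lip_norm M d f"
    using assms unfolding Lip0_dual_def by blast
  then have "\<forall>f\<in>Lip0 M d z. \<bar>c * \<phi> f\<bar> \<le> (\<bar>c\<bar> * B) * Lip_norm M d f"
    by (simp add: abs_mult mult.assoc mult_left_mono)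
  then show ?thesis
    using assms by (intro Lip0_dualI[where B = "\<bar>c\<bar> * B"]) (auto simp: Lip0_dual_def algebra_simps)
qed

lemma Lip0_dual_sum:
  assumes "\<And>k. k \<in> A \<Longrightarrow> \<phi> k \<in> Lip0_dual M d z"
  shows "(\<lambda>f. \<Sum>k\<in>A. c k * \<phi> k f) \<in> Lip0_dual M d z"
  using assms
  by (induction A rule: infinite_finite_induct)
    (auto simp: Lip0_dual_zero Lip0_dual_add Lip0_dual_cmult)

lemma Lip0_dual_diff:
  assumes "\<phi> \<in> Lip0_dual M d z" "\<psi> \<in> Lip0_dual M d z"
  shows "(\<lambda>f. \<phi> f - \<psi> f) \<in> Lip0_dual M d z"
  using Lip0_dual_add[OF assms(1) Lip0_dual_cmult[OF assms(2), of "-1"]] by simp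

lemma Lip0_dual_apply_sum:
  assumes \<phi>: "\<phi> \<in> Lip0_dual M d z" and f: "\<And>k. k \<in> A \<Longrightarrow> f k \<in> Lip0 M d z"
  shows "\<phi> (\<lambda>x. \<Sum>k\<in>A. c k * f k x) = (\<Sum>k\<in>A. c k * \<phi> (f k))"
proof -
  have add: "\<phi> (\<lambda>x. g x + h x) = \<phi> g + \<phi> h" if "g \<in> Lip0 M d z" "h \<in> Lip0 M d z" for g h
    using \<phi> that by (auto simp: Lip0_dual_def)
  have scale: "\<phi> (\<lambda>x. c * g x) = c * \<phi> g" if "g \<in> Lip0 M d z" for g c
    using \<phi> that by (auto simp: Lip0_dual_def)
  have zero: "\<phi> (\<lambda>x. 0) = 0"
    using scale[OF Lip0_zero, of 0] by simp
  show ?thesis using f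
    by (induction A rule: infinite_finite_induct)
      (auto simp: zero add scale Lip0_cmult Lip0_sum)
qed

lemma Lip0_dual_norm_le:
  assumes "\<And>f. f \<in> Lip0 M d z \<Longrightarrow> Lip_norm M d f \<le> 1 \<Longrightarrow> \<bar>\<phi> f\<bar> \<le> K"
  shows "Lip0_dual_norm M d z \<phi> \<le> K"
  unfolding Lip0_dual_norm_def
proof (rule cSUP_least)
  show "{f \<in> Lip0 M d z. Lip_norm M d f \<le> 1} \<noteq> {}"
    using Lip0_zero[of M d z] Lip_norm_zero[of M d] by (auto intro!: exI[of _ "\<lambda>x. 0"])
qed (use assms in auto)

lemma Lip0_dual_norm_upper:
  assumes \<phi>: "\<phi> \<in> Lip0_dual M d z" and "f \<in> Lip0 M d z" "Lip_norm M d f \<le> 1"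
  shows "\<bar>\<phi> f\<bar> \<le> Lip0_dual_norm M d z \<phi>"
proof -
  obtain B where B: "\<And>f. f \<in> Lip0 M d z \<Longrightarrow> \<bar>\<phi> f\<bar> \<le> B * Lip_norm M d f"
    using \<phi> unfolding Lip0_dual_def by blast
  have "bdd_above ((\<lambda>f. \<bar>\<phi> f\<bar>) ` {f \<in> Lip0 M d z. Lip_norm M d f \<le> 1})"
  proof (rule bdd_aboveI2[where M = "\<bar>B\<bar>"])
    fix f assume "f \<in> {f \<in> Lip0 M d z. Lip_norm M d f \<le> 1}"
    then have f: "f \<in> Lip0 M d z" "Lip_norm M d f \<le> 1" by auto
    have "B * Lip_norm M d f \<le> \<bar>B\<bar> * 1"
      using f Lip_norm_nonneg[OF f(1)] by (intro mult_mono) auto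
    then show "\<bar>\<phi> f\<bar> \<le> \<bar>B\<bar>" using B[OF f(1)] by simp
  qed
  then show ?thesis
    unfolding Lip0_dual_norm_def using assms by (intro cSUP_upper) auto
qed

lemma Lip0_dual_norm_nonneg:
  assumes "\<phi> \<in> Lip0_dual M d z"
  shows "0 \<le> Lip0_dual_norm M d z \<phi>"
  using Lip0_dual_norm_upper[OF assms Lip0_zero] Lip_norm_zero[of M d]
  by (smt (verit) abs_ge_zero)

lemma Lip0_dual_apply_le:
  assumes \<phi>: "\<phi> \<in> Lip0_dual M d z" and f: "f \<in> Lip0 M d z"
    and nonneg: "\<And>x y. x \<in> M \<Longrightarrow> y \<in> M \<Longrightarrow> 0 \<le> d x y"
  shows "\<bar>\<phi> f\<bar> \<le> Lip0_dual_norm M d z \<phi> * Lip_norm M d f"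
proof (cases "Lip_norm M d f = 0")
  \<comment> \<open>Such an \<open>f\<close> cannot be normalized, but boundedness of
    \<open>\<phi>\<close> already gives \<open>\<phi> f = 0\<close>.\<close>
  case True
  then show ?thesis using \<phi> f by (auto simp: Lip0_dual_def)
next
  case False
  define L where "L = Lip_norm M d f"
  have L: "L > 0" using False Lip_norm_nonneg[OF f] by (simp add: L_def)
  define g where "g = (\<lambda>x. inverse L * f x)"
  have g: "g \<in> Lip0 M d z" unfolding g_def using f by (rule Lip0_cmult)
  have "Lip_norm M d g \<le> 1"
  proof (rule Lip_norm_le)
    fix x y assume "x \<in> M" "y \<in> M"
    then have "\<bar>f x - f y\<bar> \<le> L * d x y" unfolding L_def using f nonneg by (blast intro: Lip0_abs_le)
    then show "\<bar>g x - g y\<bar> \<le> 1 * d x y"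
      using L by (simp add: g_def abs_mult field_simps flip: right_diff_distrib)
  qed simp
  then have "\<bar>\<phi> g\<bar> \<le> Lip0_dual_norm M d z \<phi>" by (rule Lip0_dual_norm_upper[OF \<phi> g])
  moreover have "\<phi> g = inverse L * \<phi> f"
    using \<phi> f unfolding g_def Lip0_dual_def by auto
  ultimately show ?thesis using L by (simp add: abs_mult field_simps flip: L_def)
qed

lemma Lip0_dual_norm_zero: "Lip0_dual_norm M d z (\<lambda>f. 0) \<le> 0"
  by (rule Lip0_dual_norm_le) simp

section \<open>Evaluations and their span\<close>

lemma evaluation_in_dual:
  assumes "x \<in> M" "z \<in> M" "0 \<le> d x z"
  shows "evaluation M d z x \<in> Lip0_dual M d z"
proof -
  have "\<bar>f x\<bar> \<le> d x z * Lip_norm M d f" if "f \<in> Lip0 M d z" for f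
    using Lip0_abs_le[OF that, of x z] assms that by (simp add: Lip0_def mult.commute)
  then show ?thesis
    by (auto simp: Lip0_dual_def evaluation_def Lip0_add Lip0_cmult)
qed

lemma evaluation_span_in_dual:
  assumes "\<psi> \<in> evaluation_span M d z" "z \<in> M" "\<And>x. x \<in> M \<Longrightarrow> 0 \<le> d x z"
  shows "\<psi> \<in> Lip0_dual M d z"
  using assms by (auto simp: evaluation_span_def intro!: Lip0_dual_sum evaluation_in_dual)

lemma evaluation_span_in_free_space:
  assumes "\<psi> \<in> evaluation_span M d z" "z \<in> M" "\<And>x. x \<in> M \<Longrightarrow> 0 \<le> d x z"
  shows "\<psi> \<in> free_space M d z"
  using evaluation_span_in_dual[OF assms] assms(1) Lip0_dual_norm_zero[of M d z]
  by (auto simp: free_space_def intro!: bexI[of _ \<psi>])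

text \<open>The first ancestor of \<open>i\<close> among \<open>0, \<dots>, n\<close> in the tree with parent function \<open>par\<close>;
  the guard \<open>par i < i\<close> only serves termination.\<close>

function ancestor :: "(nat \<Rightarrow> nat) \<Rightarrow> nat \<Rightarrow> nat \<Rightarrow> nat" where
  "ancestor par n i = (if n < i \<and> par i < i then ancestor par n (par i) else i)"
  by pat_completeness auto
termination by (relation "Wellfounded.measure (\<lambda>(par, n, i). i)") auto

declare ancestor.simps [simp del]

lemma ancestor_id: "i \<le> n \<Longrightarrow> ancestor par n i = i"
  by (simp add: ancestor.simps)

lemma ancestor_step: "n < i \<Longrightarrow> par i < i \<Longrightarrow> ancestor par n i = ancestor par n (par i)"
  by (simp add: ancestor.simps)

context
  fixes par :: "nat \<Rightarrow> nat"
  assumes par_less: "\<And>i. 0 < i \<Longrightarrow> par i < i"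
begin

lemma ancestor_le: "ancestor par n i \<le> n"
proof (induction i rule: less_induct)
  case (less i)
  then show ?case
    using par_less[of i] by (cases "i \<le> n") (auto simp: ancestor_id ancestor_step)
qed

text \<open>Stopping at \<open>n\<close> on the way does not change where the path towards the root
  first meets the indices up to \<open>m\<close>. This is why the retractions commute.\<close>

lemma ancestor_ancestor: "m \<le> n \<Longrightarrow> ancestor par m (ancestor par n i) = ancestor par m i"
proof (induction i rule: less_induct)
  case (less i)
  then show ?case
    using par_less[of i] by (cases "i \<le> n") (auto simp: ancestor_id ancestor_step)
qed

lemma ancestor_Suc:
  assumes "ancestor par (Suc n) i \<noteq> Suc n"
  shows "ancestor par (Suc n) i = ancestor par n i"
proof -
  have "ancestor par (Suc n) i \<le> n" using assms ancestor_le[of "Suc n" i] by simp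
  then show ?thesis
    using ancestor_ancestor[of n "Suc n" i] by (simp add: ancestor_id)
qed

end

text \<open>Evaluation at the base point is zero, so index 0 carries no basis vector; hence the
  shift to \<open>Suc k\<close>. Since \<open>par (Suc k) \<le> k\<close>, the index
  \<open>ancestor par k (Suc k)\<close> is just the parent, in a form that suits
  \<open>ancestor_ancestor\<close>.\<close>

theorem tree_retractions_schauder_basis:
  fixes x :: "nat \<Rightarrow> 'a" and par :: "nat \<Rightarrow> nat" and d :: "'a \<Rightarrow> 'a \<Rightarrow> real"
  assumes bij: "bij_betw x UNIV M"
    and nonneg: "\<And>u v. u \<in> M \<Longrightarrow> v \<in> M \<Longrightarrow> 0 \<le> d u v"
    and "0 < a" and sep: "\<And>u v. u \<in> M \<Longrightarrow> v \<in> M \<Longrightarrow> u \<noteq> v \<Longrightarrow> a \<le> d u v"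
    and par_less: "\<And>i. 0 < i \<Longrightarrow> par i < i"
    and "0 \<le> C"
    and lip: "\<And>n i j. d (x (ancestor par n i)) (x (ancestor par n j)) \<le> C * d (x i) (x j)"
  shows "schauder_basis (free_space M d (x 0)) (Lip0_dual_norm M d (x 0))
     (\<lambda>k f. evaluation M d (x 0) (x (Suc k)) f - evaluation M d (x 0) (x (ancestor par k (Suc k))) f)"
proof -
  define z where "z = x 0"
  define e where "e = (\<lambda>k f. evaluation M d z (x (Suc k)) f
      - evaluation M d z (x (ancestor par k (Suc k))) f)"
  define ix where "ix = inv x"
  let ?anc = "ancestor par"
  have inj: "inj x" and ran: "range x = M" using bij by (auto simp: bij_betw_def)
  have xM [simp]: "x i \<in> M" for i using ran by auto
  have ix [simp]: "ix (x i) = i" for i unfolding ix_def using inj by simp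
  have x_ix: "x (ix u) = u" if "u \<in> M" for u
    unfolding ix_def using that ran by (simp add: f_inv_into_f)
  have zM: "z \<in> M" by (simp add: z_def)

  text \<open>The coordinate functional of \<open>e k\<close> is evaluation at the indicator of the set of
    descendants of \<open>x (Suc k)\<close>.\<close>
  define desc where "desc = (\<lambda>k u. if u \<in> M \<and> ?anc (Suc k) (ix u) = Suc k then 1 else 0 :: real)"
  have desc_Lip: "desc k \<in> Lip0 M d z" for k
  \<comment> \<open>An indicator jumps by at most 1, and distinct points are at distance at least
    \<open>a\<close>.\<close>
  proof (rule Lip0I[where C = "1 / a"])
    show "\<bar>desc k u - desc k v\<bar> \<le> 1 / a * d u v" if "u \<in> M" "v \<in> M" for u v
      using sep[OF that] nonneg[OF that] \<open>0 < a\<close>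
      by (cases "u = v") (auto simp: desc_def field_simps)
    show "desc k z = 0" by (simp add: desc_def z_def ancestor_id)
  qed (use \<open>0 < a\<close> in \<open>auto simp: desc_def\<close>)

  have e_eq: "e k f = f (x (Suc k)) - f (x (?anc k (Suc k)))" if "f \<in> Lip0 M d z" for k f
    using that by (simp add: e_def evaluation_def)

  have biorth: "e k (desc j) = (if k = j then 1 else 0)" for k j
  \<comment> \<open>For \<open>j < k\<close>, a point and its parent are both descendants of
    \<open>x (Suc j)\<close> or both not. Otherwise the parent has index at most \<open>j\<close>,
    so it is no descendant.\<close>
  proof (cases "j < k")
    case True
    then have "?anc (Suc j) (?anc k (Suc k)) = ?anc (Suc j) (Suc k)"
      using ancestor_ancestor[of par "Suc j" k, OF par_less] by simp
    then show ?thesis unfolding e_eq[OF desc_Lip] using True by (simp add: desc_def)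
  next
    case False
    then have "?anc k (Suc k) < Suc j"
      using ancestor_le[of par k "Suc k", OF par_less] by simp
    then show ?thesis unfolding e_eq[OF desc_Lip] using False by (auto simp: desc_def ancestor_id)
  qed

  \<comment> \<open>Pullback along the retraction with index \<open>m\<close>; by
    \<open>apply_P\<close> below its adjoint is the partial sum operator. The guard keeps the result
    zero outside \<open>M\<close>, as \<open>Lip0\<close> demands.\<close>
  define P where "P = (\<lambda>m f u. if u \<in> M then f (x (?anc m (ix u))) else 0 :: real)"
  have P_sum: "P m f = (\<lambda>u. \<Sum>k<m. e k f * desc k u)" if f: "f \<in> Lip0 M d z" for m f
  proof
    fix u
    show "P m f u = (\<Sum>k<m. e k f * desc k u)"
    proof (cases "u \<in> M")
      case True
      show ?thesis
      proof (induction m)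
        case 0
        have "?anc 0 (ix u) = 0" using ancestor_le[of par 0, OF par_less] by simp
        then show ?case using f by (simp add: P_def Lip0_def z_def)
      next
        case (Suc m)
        \<comment> \<open>Consecutive retractions differ only on the descendants of
          \<open>x (Suc m)\<close>: one sends them to that point, the other to its parent.\<close>
        have "P (Suc m) f u = P m f u + e m f * desc m u"
        proof (cases "?anc (Suc m) (ix u) = Suc m")
          case T: True
          then have "?anc m (ix u) = ?anc m (Suc m)"
            using ancestor_ancestor[of par m "Suc m" "ix u", OF par_less] by simp
          then show ?thesis using True T f by (simp add: P_def desc_def e_eq)
        next
          case F: False
          then show ?thesis
            using ancestor_Suc[of par m "ix u", OF par_less] True by (simp add: P_def desc_def)
        qed
        then show ?case using Suc by simp
      qed
    qed (simp add: P_def desc_def)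
  qed
  have P_Lip: "P m f \<in> Lip0 M d z" if "f \<in> Lip0 M d z" for m f
    unfolding P_sum[OF that] by (rule Lip0_sum) (rule desc_Lip)
  have P_norm: "Lip_norm M d (P m f) \<le> C * Lip_norm M d f" if f: "f \<in> Lip0 M d z" for m f
  proof (rule Lip_norm_le)
    show "0 \<le> C * Lip_norm M d f" using \<open>0 \<le> C\<close> Lip_norm_nonneg[OF f] by simp
    fix u v assume uv: "u \<in> M" "v \<in> M"
    have "\<bar>P m f u - P m f v\<bar>
        \<le> Lip_norm M d f * d (x (?anc m (ix u))) (x (?anc m (ix v)))"
      using Lip0_abs_le[OF f xM xM nonneg[OF xM xM]] uv by (simp add: P_def)
    also have "\<dots> \<le> Lip_norm M d f * (C * d u v)"
      using lip[of m "ix u" "ix v"] uv Lip_norm_nonneg[OF f] by (intro mult_left_mono) (auto simp: x_ix)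
    finally show "\<bar>P m f u - P m f v\<bar> \<le> C * Lip_norm M d f * d u v" by (simp add: mult_ac)
  qed
  have apply_P: "\<phi> (P m f) = (\<Sum>k<m. e k f * \<phi> (desc k))"
    if "\<phi> \<in> Lip0_dual M d z" "f \<in> Lip0 M d z" for \<phi> m f
    unfolding P_sum[OF that(2)] by (rule Lip0_dual_apply_sum[OF that(1)]) (rule desc_Lip)

  have e_span: "e k \<in> evaluation_span M d z" for k
  proof -
    have "?anc k (Suc k) \<noteq> Suc k" using ancestor_le[of par k "Suc k", OF par_less] by simp
    then have ne: "x (?anc k (Suc k)) \<noteq> x (Suc k)" using inj by (auto dest: injD)
    show ?thesis unfolding evaluation_span_def
      by (rule CollectI, rule exI[of _ "\<lambda>u. if u = x (Suc k) then 1 else -1"],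
          rule exI[of _ "{x (Suc k), x (?anc k (Suc k))}"]) (use ne in \<open>auto simp: e_def\<close>)
  qed
  have e_free: "e k \<in> free_space M d z" for k
    by (intro evaluation_span_in_free_space e_span zM nonneg)
  have e_dual: "e k \<in> Lip0_dual M d z" for k
    by (intro evaluation_span_in_dual[OF e_span] zM nonneg)

  have expansion: "(\<lambda>m. Lip0_dual_norm M d z (\<lambda>f. \<phi> f - (\<Sum>k<m. \<phi> (desc k) * e k f)))
      \<longlonglongrightarrow> 0" (is "?r \<longlonglongrightarrow> 0") if \<phi>: "\<phi> \<in> free_space M d z" for \<phi>
  proof (rule LIMSEQ_I)
    fix \<epsilon> :: real assume "0 < \<epsilon>"
    \<comment> \<open>Replacing \<open>\<phi>\<close> by \<open>\<psi>\<close> costs at most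
      \<open>\<eta>\<close> at \<open>f\<close> and \<open>C * \<eta>\<close> at
      \<open>P m f\<close>.\<close>
    define \<eta> where "\<eta> = \<epsilon> / (2 * (1 + C))"
    have \<eta>: "\<eta> > 0" "(1 + C) * \<eta> < \<epsilon>"
      using \<open>0 < \<epsilon>\<close> \<open>0 \<le> C\<close> by (auto simp: \<eta>_def divide_simps intro!: mult_pos_pos)
    obtain \<psi> where \<psi>: "\<psi> \<in> evaluation_span M d z" "Lip0_dual_norm M d z (\<lambda>f. \<phi> f - \<psi> f) < \<eta>"
      using \<phi> \<eta>(1) by (auto simp: free_space_def)
    have \<phi>d: "\<phi> \<in> Lip0_dual M d z" using \<phi> by (simp add: free_space_def)
    have diff: "(\<lambda>f. \<phi> f - \<psi> f) \<in> Lip0_dual M d z"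
      by (intro Lip0_dual_diff \<phi>d evaluation_span_in_dual[OF \<psi>(1)] zM nonneg)
    obtain c S where S: "finite S" "S \<subseteq> M" and \<psi>_eq: "\<psi> = (\<lambda>f. \<Sum>u\<in>S. c u * evaluation M d z u f)"
      using \<psi>(1) by (auto simp: evaluation_span_def)
    \<comment> \<open>From index \<open>n0\<close> on, the retractions fix the support of
      \<open>\<psi>\<close>, so the projections reproduce \<open>\<psi>\<close> exactly.\<close>
    obtain n0 where n0: "\<And>u. u \<in> S \<Longrightarrow> ix u \<le> n0"
      using S(1) by (metis finite_imageI finite_nat_set_iff_bounded_le imageI)
    show "\<exists>n0. \<forall>m\<ge>n0. norm (?r m - 0) < \<epsilon>"
    proof (intro exI[of _ n0] allI impI)
      fix m assume m: "n0 \<le> m"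
      have fix\<psi>: "\<psi> (P m f) = \<psi> f" if f: "f \<in> Lip0 M d z" for f
        unfolding \<psi>_eq
      proof (rule sum.cong)
        fix u assume "u \<in> S"
        then have "ix u \<le> m" "u \<in> M" using n0 m S by force+
        then show "c u * evaluation M d z u (P m f) = c u * evaluation M d z u f"
          using f P_Lip by (simp add: evaluation_def P_def ancestor_id x_ix)
      qed simp
      have rem: "(\<lambda>f. \<phi> f - (\<Sum>k<m. \<phi> (desc k) * e k f)) \<in> Lip0_dual M d z"
        by (intro Lip0_dual_diff \<phi>d Lip0_dual_sum e_dual)
      have "?r m \<le> (1 + C) * \<eta>"
      proof (rule Lip0_dual_norm_le)
        fix f assume f: "f \<in> Lip0 M d z" "Lip_norm M d f \<le> 1"
        have bd: "\<bar>\<phi> g - \<psi> g\<bar> \<le> \<eta> * Lip_norm M d g" if "g \<in> Lip0 M d z" for g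
        proof -
          have "\<bar>\<phi> g - \<psi> g\<bar> \<le> Lip0_dual_norm M d z (\<lambda>f. \<phi> f - \<psi> f) * Lip_norm M d g"
            by (rule Lip0_dual_apply_le[OF diff that nonneg])
          also have "\<dots> \<le> \<eta> * Lip_norm M d g"
            using \<psi>(2) Lip_norm_nonneg[OF that] by (intro mult_right_mono) auto
          finally show ?thesis .
        qed
        have "\<bar>\<phi> f - \<psi> f\<bar> \<le> \<eta> * 1"
          by (rule order_trans[OF bd[OF f(1)]]) (use f(2) \<eta>(1) in \<open>intro mult_left_mono; simp\<close>)
        moreover have "\<bar>\<phi> (P m f) - \<psi> f\<bar> \<le> \<eta> * (C * 1)"
        proof -
          have "Lip_norm M d (P m f) \<le> C * 1"
            by (rule order_trans[OF P_norm[OF f(1)]])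
              (use f(2) \<open>0 \<le> C\<close> in \<open>intro mult_left_mono; simp\<close>)
          then have "\<eta> * Lip_norm M d (P m f) \<le> \<eta> * (C * 1)"
            using \<eta>(1) by (intro mult_left_mono) auto
          then show ?thesis using bd[OF P_Lip[OF f(1)]] fix\<psi>[OF f(1)] by (metis order_trans)
        qed
        ultimately have "\<bar>\<phi> f - \<phi> (P m f)\<bar> \<le> (1 + C) * \<eta>" by (simp add: algebra_simps)
        then show "\<bar>\<phi> f - (\<Sum>k<m. \<phi> (desc k) * e k f)\<bar> \<le> (1 + C) * \<eta>"
          by (simp add: apply_P[OF \<phi>d f(1)] mult.commute)
      qed
      moreover have "0 \<le> ?r m" using Lip0_dual_norm_nonneg[OF rem] .
      ultimately show "norm (?r m - 0) < \<epsilon>" using \<eta>(2) by simp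
    qed
  qed

  \<comment> \<open>By \<open>biorth\<close>, every remainder with \<open>m > j\<close> takes the
    same value \<open>\<phi> (desc j) - b j\<close> at \<open>desc j\<close>, while the remainders
    tend to zero in norm.\<close>
  have unique: "b j = \<phi> (desc j)"
    if \<phi>: "\<phi> \<in> free_space M d z"
      and lim: "(\<lambda>m. Lip0_dual_norm M d z (\<lambda>f. \<phi> f - (\<Sum>k<m. b k * e k f))) \<longlonglongrightarrow> 0"
    for \<phi> b j
  proof -
    have \<phi>d: "\<phi> \<in> Lip0_dual M d z" using \<phi> by (simp add: free_space_def)
    have "(\<lambda>m. Lip0_dual_norm M d z (\<lambda>f. \<phi> f - (\<Sum>k<m. b k * e k f)) * Lip_norm M d (desc j)) \<longlonglongrightarrow> 0"
      using tendsto_mult_right[OF lim] by simp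
    moreover have "\<bar>\<phi> (desc j) - b j\<bar>
        \<le> Lip0_dual_norm M d z (\<lambda>f. \<phi> f - (\<Sum>k<m. b k * e k f)) * Lip_norm M d (desc j)"
      if "Suc j \<le> m" for m
    proof -
      have "(\<Sum>k<m. b k * e k (desc j)) = b j"
        using that by (simp add: biorth if_distrib cong: if_cong)
      moreover have "(\<lambda>f. \<phi> f - (\<Sum>k<m. b k * e k f)) \<in> Lip0_dual M d z"
        by (intro Lip0_dual_diff \<phi>d Lip0_dual_sum e_dual)
      ultimately show ?thesis
        using Lip0_dual_apply_le[OF _ desc_Lip[of j] nonneg] by fastforce
    qed
    ultimately have "\<bar>\<phi> (desc j) - b j\<bar> \<le> 0"
      by (intro LIMSEQ_le_const) auto
    then show ?thesis by simp
  qed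

  have "schauder_basis (free_space M d z) (Lip0_dual_norm M d z) e"
    unfolding schauder_basis_def
  proof (intro conjI allI ballI e_free)
    fix \<phi> assume \<phi>: "\<phi> \<in> free_space M d z"
    show "\<exists>!b. (\<lambda>m. Lip0_dual_norm M d z (\<lambda>f. \<phi> f - (\<Sum>k<m. b k * e k f))) \<longlonglongrightarrow> 0"
      by (rule ex1I[of _ "\<lambda>k. \<phi> (desc k)"]) (use expansion unique \<phi> in auto)
  qed
  then show ?thesis by (simp add: e_def z_def)
qed

section \<open>Hyperbolicity\<close>

lemma minkowski_add:
  "minkowski (x + y) w = minkowski x w + minkowski y w"
  "minkowski w (x + y) = minkowski w x + minkowski w y"
  by (simp_all add: minkowski_inner algebra_simps)

lemma minkowski_scaleR:
  "minkowski (c *\<^sub>R x) w = c * minkowski x w"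
  "minkowski w (c *\<^sub>R x) = c * minkowski w x"
  by (simp_all add: minkowski_inner algebra_simps)

text \<open>The points \<open>- x / \<langle>x,z\<rangle>\<close> lie in a translate of the positive definite space \<open>z\<^sup>\<bottom>\<close>, where the
  squared norm satisfies \<open>|a - b|\<^sup>2 \<le> 2|a - c|\<^sup>2 + 2|c - b|\<^sup>2\<close>.\<close>

lemma minkowski_four_point:
  assumes "x \<in> hyperbolic_space" "y \<in> hyperbolic_space" "w \<in> hyperbolic_space" "z \<in> hyperbolic_space"
  shows "minkowski x y * minkowski w z \<le> 2 * (minkowski x w * minkowski y z + minkowski w y * minkowski x z)"
proof -
  define p q r where "p = - minkowski x z" and "q = - minkowski y z" and "r = - minkowski w z"
  have pos: "p > 0" "q > 0" "r > 0"
    using minkowski_le_minus1[OF assms(1,4)] minkowski_le_minus1[OF assms(2,4)]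
      minkowski_le_minus1[OF assms(3,4)] by (auto simp: p_def q_def r_def)
  have n: "minkowski x x = -1" "minkowski y y = -1" "minkowski w w = -1"
    using assms by (auto simp: hyperbolic_space_def)
  \<comment> \<open>Up to the factor \<open>p * q * r\<close> this is \<open>a + b - 2c\<close> for
    the normalized points \<open>a = x / p\<close>, \<open>b = y / q\<close>,
    \<open>c = w / r\<close>: the term that the parallelogram identity for \<open>a - c\<close> and
    \<open>c - b\<close> leaves over.\<close>
  define u where "u = (q * r) *\<^sub>R x + (p * r) *\<^sub>R y - (2 * p * q) *\<^sub>R w"
  have "minkowski u z = 0"
    by (simp add: u_def minkowski_diff_scaleR minkowski_add minkowski_scaleR p_def q_def r_def)
  then have "0 \<le> minkowski u u" by (rule minkowski_orthogonal(1)[OF assms(4)])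
  also have "minkowski u u = 2 * p * q * r
      * (r * minkowski x y - 2 * q * minkowski x w - 2 * p * minkowski w y)
      - (q * r)\<^sup>2 - (p * r)\<^sup>2 - (2 * p * q)\<^sup>2"
    by (simp add: u_def minkowski_diff_scaleR minkowski_add minkowski_scaleR n
        minkowski_commute[of y x] minkowski_commute[of w x] minkowski_commute[of y w]
        power2_eq_square algebra_simps)
  finally have "0 \<le> 2 * p * q * r
      * (r * minkowski x y - 2 * q * minkowski x w - 2 * p * minkowski w y)"
    by (smt (verit) zero_le_power2)
  then have "0 \<le> r * minkowski x y - 2 * q * minkowski x w - 2 * p * minkowski w y"
    using pos by (smt (verit, best) mult_pos_pos zero_le_mult_iff)
  then show ?thesis by (simp add: p_def q_def r_def algebra_simps)
qed

text \<open>Gromov's four-point condition, obtained from \<open>minkowski_four_point\<close> by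
  trading \<open>cosh\<close> for \<open>exp\<close>. The 16 collects the 2 of that inequality, 2 *
  2 from two uses of \<open>exp t \<le> 2 * cosh t\<close>, and 2 from bounding a sum by twice its
  maximum.\<close>

lemma hyperbolic_dist_four_point:
  assumes "x \<in> hyperbolic_space" "y \<in> hyperbolic_space" "w \<in> hyperbolic_space" "z \<in> hyperbolic_space"
  shows "hyperbolic_dist x y + hyperbolic_dist w z
    \<le> max (hyperbolic_dist x w + hyperbolic_dist y z) (hyperbolic_dist w y + hyperbolic_dist x z) + ln 16"
    (is "?a + ?b \<le> max (?c + ?d) (?e + ?f) + _")
proof -
  have lower: "exp t \<le> 2 * cosh t" for t :: real by (simp add: cosh_def)
  have upper: "cosh t \<le> exp t" if "0 \<le> t" for t :: real using that by (simp add: cosh_def)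
  have cosh_nonneg: "0 \<le> cosh t" for t :: real using cosh_real_ge_1[of t] by linarith
  have "exp (?a + ?b) \<le> (2 * cosh ?a) * (2 * cosh ?b)"
    unfolding exp_add by (intro mult_mono lower) (auto simp: cosh_nonneg)
  also have "\<dots> \<le> 8 * (cosh ?c * cosh ?d + cosh ?e * cosh ?f)"
    using minkowski_four_point[OF assms] by (simp add: cosh_hyperbolic_dist assms)
  also have "\<dots> \<le> 8 * (exp (?c + ?d) + exp (?e + ?f))"
    unfolding exp_add
    by (intro mult_left_mono add_mono mult_mono upper hyperbolic_dist_nonneg assms)
      (auto simp: cosh_nonneg)
  also have "\<dots> \<le> 16 * exp (max (?c + ?d) (?e + ?f))"
    by (smt (verit) exp_le_cancel_iff max.cobounded1 max.cobounded2)
  also have "\<dots> = exp (max (?c + ?d) (?e + ?f) + ln 16)"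
    by (simp add: exp_add)
  finally show ?thesis by simp
qed

lemma hyperbolic_geodesic_point:
  assumes x: "x \<in> hyperbolic_space" and z: "z \<in> hyperbolic_space"
    and R: "0 \<le> R" "R \<le> hyperbolic_dist x z"
  obtains g where "g \<in> hyperbolic_space" "hyperbolic_dist x g = R"
    "hyperbolic_dist g z = hyperbolic_dist x z - R"
proof (cases "hyperbolic_dist x z = 0")
  case True
  then show ?thesis using that[of x] assms hyperbolic_dist_eq_0_iff[OF x x] by simp
next
  case False
  define r where "r = hyperbolic_dist x z"
  have r: "r > 0" using False hyperbolic_dist_nonneg[OF x z] by (simp add: r_def)
  have xz: "minkowski x z = - cosh r" using cosh_hyperbolic_dist[OF x z] by (simp add: r_def)
  have n: "minkowski x x = -1" "minkowski z z = -1" "snd x > 0" "snd z > 0"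
    using x z by (auto simp: hyperbolic_space_def)
  define s where "s = sinh r"
  have s: "s > 0" using r by (simp add: s_def)
  \<comment> \<open>The hyperboloid analogue of linear interpolation: the point at time
    \<open>R\<close> on the unit speed geodesic from \<open>x\<close> to \<open>z\<close>.\<close>
  define g where "g = (sinh (r - R) / s) *\<^sub>R x + (sinh R / s) *\<^sub>R z"
  have gx: "minkowski x g = - cosh R"
    using s by (simp add: g_def minkowski_add minkowski_scaleR n xz sinh_diff field_simps flip: s_def)
  have gz: "minkowski g z = - cosh (r - R)"
  proof -
    have "sinh R + cosh r * sinh (r - R) = s * cosh (r - R)"
      using sinh_diff[of r "r - R"] by (simp add: s_def algebra_simps)
    then show ?thesis
      using s by (simp add: g_def minkowski_add minkowski_scaleR n xz field_simps)
  qed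
  have gg: "minkowski g g = -1"
  proof -
    have "minkowski g g = - (sinh (r - R) * cosh R + cosh (r - R) * sinh R) / s"
      using gx gz by (simp add: g_def[THEN arg_cong, of "minkowski g"] minkowski_add minkowski_scaleR
          minkowski_commute[of g x] add_divide_distrib diff_divide_distrib mult.commute)
    also have "\<dots> = -1" using s sinh_add[of "r - R" R] by (simp add: field_simps flip: s_def)
    finally show ?thesis .
  qed
  have "R > 0 \<or> r - R > 0" using r by linarith
  then have "0 < sinh (r - R) / s \<or> 0 < sinh R / s" using s by auto
  moreover have "0 \<le> sinh (r - R) / s" "0 \<le> sinh R / s" using R s by (auto simp: r_def)
  ultimately have "snd g > 0"
    unfolding g_def using n(3,4)
    by (smt (verit, ccfv_SIG) mult_nonneg_nonneg mult_pos_pos real_scaleR_def snd_add snd_scaleR)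
  then have g: "g \<in> hyperbolic_space" using gg by (simp add: hyperbolic_space_def)
  show ?thesis
  proof (rule that[OF g])
    show "hyperbolic_dist x g = R" using R(1) by (simp add: hyperbolic_dist_def gx arcosh_cosh_real)
    show "hyperbolic_dist g z = hyperbolic_dist x z - R"
      using R by (simp add: hyperbolic_dist_def[of g] gz r_def arcosh_cosh_real)
  qed
qed

text \<open>In terms of \<open>2(u|v) = h u + h v - d u v\<close>, the four-point condition propagates
  \<open>(x i|x j) \<ge> h (x j) - const\<close> along chains of ancestors, because each step decreases \<open>h\<close> by at
  least \<open>D\<close>.\<close>

lemma ancestor_Lipschitz:
  fixes x :: "nat \<Rightarrow> 'a" and d :: "'a \<Rightarrow> 'a \<Rightarrow> real"
  defines "h \<equiv> \<lambda>i. d (x i) (x 0)"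
  assumes nonneg: "\<And>i j. 0 \<le> d (x i) (x j)"
    and diag: "\<And>i. d (x i) (x i) = 0"
    and sym: "\<And>i j. d (x i) (x j) = d (x j) (x i)"
    and tri: "\<And>i j k. d (x i) (x k) \<le> d (x i) (x j) + d (x j) (x k)"
    and "0 < a" and sep: "\<And>i j. i \<noteq> j \<Longrightarrow> a \<le> d (x i) (x j)"
    and four: "\<And>i j k. d (x i) (x j) + h k \<le> max (d (x i) (x k) + h j) (d (x k) (x j) + h i) + D"
    and "0 \<le> D" "0 \<le> \<beta>" "0 \<le> S"
    and mono: "\<And>i j. i \<le> j \<Longrightarrow> h i \<le> h j"
    and par_less: "\<And>i. 0 < i \<Longrightarrow> par i < i"
    and step: "\<And>i. 0 < i \<Longrightarrow> h i - S \<le> h (par i)"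
    and descent: "\<And>i. 0 < i \<Longrightarrow> par i \<noteq> 0 \<Longrightarrow> h (par i) \<le> h i - D"
    and straight: "\<And>i. 0 < i \<Longrightarrow> d (x i) (x (par i)) \<le> h i - h (par i) + \<beta>"
  shows "\<exists>C\<ge>0. \<forall>n i j. d (x (ancestor par n i)) (x (ancestor par n j)) \<le> C * d (x i) (x j)"
proof -
  define \<kappa> where "\<kappa> = \<beta> + D"
  let ?anc = "ancestor par"
  have h0: "h 0 = 0" using diag by (simp add: h_def)
  have chain: "d (x i) (x ((par ^^ k) i)) \<le> h i - h ((par ^^ k) i) + \<kappa>"
    if "\<forall>l<k. 0 < (par ^^ l) i" for i k
    using that
  proof (induction k)
    case 0
    then show ?case using diag \<open>0 \<le> D\<close> \<open>0 \<le> \<beta>\<close> by (simp add: \<kappa>_def)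
  next
    case (Suc k)
    let ?v = "(par ^^ k) i"
    have IH: "d (x i) (x ?v) \<le> h i - h ?v + \<kappa>" and v: "0 < ?v" using Suc by auto
    show ?case
    proof (cases "par ?v = 0")
      case True
      then show ?thesis using h0 \<open>0 \<le> D\<close> \<open>0 \<le> \<beta>\<close> by (simp add: \<kappa>_def h_def)
    next
      case False
      \<comment> \<open>If the second term of the maximum wins, \<open>straight\<close> alone gives
        the error \<open>\<beta> + D\<close>, without the induction hypothesis. If the first wins,
        the old error is inherited and the drop in height from \<open>descent\<close> absorbs the
        new \<open>D\<close>.\<close>
      then show ?thesis
        using descent[OF v False] straight[OF v] IH four[of i "par ?v" ?v] \<open>0 \<le> D\<close>
        by (simp add: \<kappa>_def max_def split: if_splits)
    qed
  qed
  have "\<exists>k. ?anc n i = (par ^^ k) i \<and> (\<forall>l<k. 0 < (par ^^ l) i)" for n i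
  proof (induction i rule: less_induct)
    case (less i)
    show ?case
    proof (cases "i \<le> n")
      case True
      then show ?thesis by (intro exI[of _ 0]) (simp add: ancestor_id)
    next
      case False
      then obtain k where "?anc n (par i) = (par ^^ k) (par i)" "\<forall>l<k. 0 < (par ^^ l) (par i)"
        using less[of "par i"] par_less[of i] by auto
      then show ?thesis
        using False par_less[of i]
        by (intro exI[of _ "Suc k"])
          (auto simp: ancestor_step funpow_Suc_right less_Suc_eq_0_disj simp del: funpow.simps(2))
    qed
  qed
  then have anc: "d (x i) (x (?anc n i)) \<le> h i - h (?anc n i) + \<kappa>" for n i
    using chain by metis
  have anc_h: "h (?anc n i) \<le> h i" for n i
  proof (induction i rule: less_induct)
    case (less i)
    then show ?case
      using par_less[of i] mono[of "par i" i]
      by (cases "i \<le> n") (force simp: ancestor_id ancestor_step)+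
  qed
  have anc_low: "h n - S \<le> h (?anc n i)" if "n < i" for n i
    using that
  proof (induction i rule: less_induct)
    case (less i)
    then show ?case
      using par_less[of i] step[of i] mono[of n i]
      by (cases "par i \<le> n") (auto simp: ancestor_id ancestor_step)
  qed
  have anc_up: "h (?anc n i) \<le> h n" for n i
    using mono ancestor_le[of par, OF par_less] by blast
  have h_diff: "\<bar>h i - h j\<bar> \<le> d (x i) (x j)" for i j
    using tri[of i 0 j] tri[of j 0 i] sym[of i j] by (simp add: h_def)
  have key: "d (x (?anc n i)) (x (?anc n j)) \<le> S + 2 * d (x i) (x j) + (\<kappa> + 2 * D)" for n i j
  proof -
    let ?u = "?anc n i" and ?v = "?anc n j" and ?L = "d (x i) (x j)"
    have L: "0 \<le> ?L" using nonneg .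
    \<comment> \<open>Ancestors of points beyond \<open>n\<close> have height between
      \<open>h n - S\<close> and \<open>h n\<close>. In the mixed cases \<open>h n\<close> lies
      between \<open>h i\<close> and \<open>h j\<close>, which differ by at most
      \<open>?L\<close>.\<close>
    have "\<bar>h ?u - h ?v\<bar> \<le> S + ?L"
    proof (cases "i \<le> n"; cases "j \<le> n")
      assume "i \<le> n" "j \<le> n"
      then show ?thesis using h_diff[of i j] \<open>0 \<le> S\<close> by (simp add: ancestor_id)
    next
      assume "i \<le> n" "\<not> j \<le> n"
      then show ?thesis
        using h_diff[of i j] anc_low[of n j] anc_up[of n j] mono[of n j] mono[of i n] \<open>0 \<le> S\<close>
        by (simp add: ancestor_id)
    next
      assume "\<not> i \<le> n" "j \<le> n"
      then show ?thesis
        using h_diff[of i j] anc_low[of n i] anc_up[of n i] mono[of n i] mono[of j n] \<open>0 \<le> S\<close>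
        by (simp add: ancestor_id)
    next
      assume "\<not> i \<le> n" "\<not> j \<le> n"
      then show ?thesis
        using anc_low[of n i] anc_up[of n i] anc_low[of n j] anc_up[of n j] L by simp
    qed
    \<comment> \<open>Two comparisons pass from the pair \<open>?u\<close>, \<open>?v\<close>
      through \<open>i\<close>, \<open>?v\<close> to \<open>i\<close>, \<open>j\<close>; each costs
      \<open>D\<close>, and \<open>anc\<close> bounds the distances from \<open>i\<close> and
      \<open>j\<close> to their ancestors.\<close>
    moreover have "d (x ?u) (x ?v) + h i \<le> max (d (x ?u) (x i) + h ?v) (d (x i) (x ?v) + h ?u) + D"
      "d (x i) (x ?v) + h j \<le> max (?L + h ?v) (d (x j) (x ?v) + h i) + D"
      by (rule four)+
    ultimately show ?thesis
      using anc[of i n] anc[of j n] anc_h[of n i] anc_h[of n j] sym[of i ?u] h_diff[of i j] L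
        \<open>0 \<le> D\<close> \<open>0 \<le> \<beta>\<close> \<open>0 \<le> S\<close>
      unfolding \<kappa>_def by (smt (verit))
  qed
  \<comment> \<open>Distinct points are at distance at least \<open>a\<close>, so the additive
    constant of \<open>key\<close> becomes a multiple of the distance.\<close>
  define C where "C = 2 + (S + \<kappa> + 2 * D) / a"
  have "0 \<le> S + \<kappa> + 2 * D" using \<open>0 \<le> D\<close> \<open>0 \<le> \<beta>\<close> \<open>0 \<le> S\<close> by (simp add: \<kappa>_def)
  have "d (x (?anc n i)) (x (?anc n j)) \<le> C * d (x i) (x j)" for n i j
  proof (cases "i = j")
    case True
    then show ?thesis using diag by simp
  next
    case False
    have "(S + \<kappa> + 2 * D) / a * a \<le> (S + \<kappa> + 2 * D) / a * d (x i) (x j)"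
      using sep[OF False] \<open>0 < a\<close> \<open>0 \<le> S + \<kappa> + 2 * D\<close> by (intro mult_left_mono) auto
    then have "S + \<kappa> + 2 * D \<le> (S + \<kappa> + 2 * D) / a * d (x i) (x j)" using \<open>0 < a\<close> by simp
    then show ?thesis using key[of n i j] unfolding C_def distrib_right by linarith
  qed
  moreover have "0 \<le> C" using \<open>0 < a\<close> \<open>0 \<le> S + \<kappa> + 2 * D\<close> by (simp add: C_def)
  ultimately show ?thesis by blast
qed

section \<open>Local finiteness and enumeration of nets\<close>

lemma hyperbolic_space_Pair:
  "(v, t) \<in> hyperbolic_space \<longleftrightarrow> 0 < t \<and> t\<^sup>2 = 1 + (norm v)\<^sup>2"
  unfolding hyperbolic_space_def minkowski_inner power2_norm_eq_inner
  by (auto simp: power2_eq_square)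

text \<open>The centre \<open>(v, t)\<close> satisfies \<open>norm v < t\<close>, so
  \<open>- minkowski x z\<close>, at most \<open>cosh r\<close> on the ball, dominates a positive
  multiple of the last coordinate of \<open>x\<close>, which in turn dominates the others.\<close>

lemma bounded_hyperbolic_ball:
  fixes z :: "(real^'n) \<times> real"
  assumes z: "z \<in> hyperbolic_space"
  shows "bounded {x \<in> hyperbolic_space. hyperbolic_dist x z \<le> r}"
proof -
  obtain v t where zvt: "z = (v, t)" by (cases z)
  have t: "t > 0" "t\<^sup>2 = 1 + (norm v)\<^sup>2"
    using z by (auto simp: zvt hyperbolic_space_Pair)
  have vt: "norm v < t" by (rule power2_less_imp_less) (use t in simp_all)
  have "norm x \<le> 2 * (cosh r / (t - norm v))"
    if x: "x \<in> hyperbolic_space" and d: "hyperbolic_dist x z \<le> r" for x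
  proof -
    obtain u s where xus: "x = (u, s)" by (cases x)
    have s: "s > 0" "s\<^sup>2 = 1 + (norm u)\<^sup>2"
      using x by (auto simp: xus hyperbolic_space_Pair)
    have us: "norm u \<le> s" by (rule power2_le_imp_le) (use s in simp_all)
    have "u \<bullet> v \<le> s * norm v"
      using norm_cauchy_schwarz[of u v] mult_right_mono[OF us, of "norm v"] by simp
    then have "s * (t - norm v) \<le> - minkowski x z"
      by (simp add: xus zvt minkowski_inner algebra_simps)
    also have "\<dots> \<le> cosh r"
      using d hyperbolic_dist_nonneg[OF x z]
      by (simp add: cosh_hyperbolic_dist[OF x z, symmetric] cosh_real_nonneg_le_iff)
    finally have "s \<le> cosh r / (t - norm v)" using vt by (simp add: field_simps)
    then show ?thesis using norm_Pair_le[of u s] us s by (simp add: xus)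
  qed
  then show ?thesis by (intro boundedI) auto
qed

lemma unbounded_hyperbolic_space:
  "\<not> bounded (hyperbolic_space :: ((real^'n) \<times> real) set)"
proof
  assume "bounded (hyperbolic_space :: ((real^'n) \<times> real) set)"
  then obtain B where B: "\<And>x :: (real^'n) \<times> real. x \<in> hyperbolic_space \<Longrightarrow> norm x \<le> B"
    by (auto simp: bounded_iff)
  define v :: "real^'n" where "v = (\<bar>B\<bar> + 1) *\<^sub>R axis undefined 1"
  have "(v, sqrt (1 + v \<bullet> v)) \<in> hyperbolic_space"
    by (simp add: hyperbolic_space_Pair power2_norm_eq_inner add_pos_nonneg)
  then have "norm (v, sqrt (1 + v \<bullet> v)) \<le> B" by (rule B)
  moreover have "norm v \<le> norm (v, sqrt (1 + v \<bullet> v))" using norm_fst_le by fastforce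
  ultimately show False by (simp add: v_def norm_axis_1)
qed

lemma finite_separated_hyperbolic_ball:
  fixes N :: "((real^'n) \<times> real) set"
  assumes N: "N \<subseteq> hyperbolic_space" and z: "z \<in> hyperbolic_space" and "0 < a"
    and sep: "\<And>x y. x \<in> N \<Longrightarrow> y \<in> N \<Longrightarrow> x \<noteq> y \<Longrightarrow> a \<le> hyperbolic_dist x y"
  shows "finite {x \<in> N. hyperbolic_dist x z \<le> r}"
proof -
  have "bounded {x \<in> N. hyperbolic_dist x z \<le> r}"
    by (rule bounded_subset[OF bounded_hyperbolic_ball[OF z, of r]]) (use N in auto)
  moreover have "uniform_discrete N"
    unfolding uniform_discrete_def
  proof (intro exI conjI ballI impI)
    \<comment> \<open>At hyperbolic distance \<open>a\<close> the Minkowski square of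
      \<open>x - y\<close> is \<open>2 * (cosh a - 1)\<close>, and it never exceeds the Euclidean
      square. Bounded Euclidean-separated sets are finite.\<close>
    show "0 < sqrt (2 * (cosh a - 1))"
      using cosh_real_strict_mono[of 0 a] \<open>0 < a\<close> by simp
    fix x y assume xy: "x \<in> N" "y \<in> N" "dist x y < sqrt (2 * (cosh a - 1))"
    then have xyH: "x \<in> hyperbolic_space" "y \<in> hyperbolic_space" using N by auto
    then have n: "minkowski x x = -1" "minkowski y y = -1" by (auto simp: hyperbolic_space_def)
    show "x = y"
    proof (rule ccontr)
      assume "x \<noteq> y"
      then have "a \<le> hyperbolic_dist x y" using sep xy by blast
      then have "cosh a \<le> - minkowski x y"
        using \<open>0 < a\<close> hyperbolic_dist_nonneg[OF xyH]
        by (simp add: cosh_hyperbolic_dist[OF xyH, symmetric] cosh_real_nonneg_le_iff)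
      then have "2 * (cosh a - 1) \<le> minkowski (x - 1 *\<^sub>R y) (x - 1 *\<^sub>R y)"
        unfolding minkowski_diff_scaleR by (simp add: n minkowski_commute[of y x])
      also have "\<dots> \<le> (x - y) \<bullet> (x - y)"
        by (simp add: minkowski_inner inner_prod_def)
      also have "\<dots> = (dist x y)\<^sup>2" by (simp add: dist_norm power2_norm_eq_inner)
      finally have "sqrt (2 * (cosh a - 1)) \<le> dist x y" by (simp add: real_le_lsqrt real_sqrt_le_iff)
      then show False using xy(3) by simp
    qed
  qed
  then have "uniform_discrete {x \<in> N. hyperbolic_dist x z \<le> r}"
    by (rule uniform_discrete_subset) auto
  ultimately show ?thesis by (simp flip: uniform_discrete_finite_iff)
qed

lemma infinite_hyperbolic_net:
  fixes N :: "((real^'n) \<times> real) set"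
  assumes "is_net hyperbolic_space hyperbolic_dist N"
  shows "infinite N"
proof
  assume "finite N"
  obtain b where NH: "N \<subseteq> hyperbolic_space"
    and b: "\<And>x. x \<in> hyperbolic_space \<Longrightarrow> \<exists>y\<in>N. hyperbolic_dist x y \<le> b"
    using assms unfolding is_net_def by blast
  have "bounded (\<Union>y\<in>N. {x \<in> hyperbolic_space. hyperbolic_dist x y \<le> b})"
    using \<open>finite N\<close> NH by (auto intro!: bounded_hyperbolic_ball)
  then have "bounded (hyperbolic_space :: ((real^'n) \<times> real) set)"
    by (rule bounded_subset) (use b in auto)
  then show False using unbounded_hyperbolic_space by blast
qed

text \<open>Ordering by \<open>f\<close>, with ties broken by an injection into the naturals, gives
  a total order with finite initial segments; counting predecessors embeds it into the
  naturals.\<close>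

lemma enumerate_by_level:
  fixes f :: "'a \<Rightarrow> real"
  assumes inf: "infinite N" and fin: "\<And>r. finite {y \<in> N. f y \<le> r}"
  obtains x :: "nat \<Rightarrow> 'a" where "bij_betw x UNIV N" "mono (\<lambda>i. f (x i))"
proof -
  have "N = (\<Union>n. {y \<in> N. f y \<le> real n})" by (auto intro: real_arch_simple)
  moreover have "countable (\<Union>n. {y \<in> N. f y \<le> real n})"
    by (intro countable_UN countable_finite fin countableI_type)
  ultimately have "countable N" by simp
  then obtain g :: "'a \<Rightarrow> nat" where g: "inj_on g N" by (auto simp: countable_def)
  define below where "below = (\<lambda>y. {w \<in> N. f w < f y \<or> f w = f y \<and> g w < g y})"
  define ix where "ix = (\<lambda>y. card (below y))"
  have fin_below: "finite (below y)" for y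
    by (rule finite_subset[OF _ fin[of "f y"]]) (auto simp: below_def)
  have less: "ix w < ix y" if "w \<in> below y" for w y
    unfolding ix_def
    by (rule psubset_card_mono[OF fin_below]) (use that in \<open>auto simp: below_def\<close>)
  have total: "w \<in> below y \<or> y \<in> below w" if "w \<in> N" "y \<in> N" "w \<noteq> y" for w y
    using that inj_onD[OF g, of w y]
    by (cases "f w" "f y" rule: linorder_cases; cases "g w" "g y" rule: linorder_cases)
      (auto simp: below_def)
  have inj: "inj_on ix N"
    by (rule inj_onI) (metis less total less_irrefl)
  have le: "f w \<le> f y" if "w \<in> N" "y \<in> N" "ix w \<le> ix y" for w y
  proof (rule ccontr)
    assume "\<not> f w \<le> f y"
    then have "y \<in> below w" using that by (auto simp: below_def)
    then show False using less that by fastforce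
  qed
  have inf_ix: "infinite (ix ` N)" using inf inj by (simp add: finite_image_iff)
  \<comment> \<open>Going through \<open>enumerate\<close> makes it unnecessary to show that
    \<open>ix\<close> is onto.\<close>
  define x where "x = inv_into N ix \<circ> enumerate (ix ` N)"
  have x_in: "x i \<in> N" and ix_x: "ix (x i) = enumerate (ix ` N) i" for i
    using enumerate_in_set[OF inf_ix, of i] by (auto simp: x_def inv_into_into f_inv_into_f)
  show ?thesis
  proof
    show "bij_betw x UNIV N"
      unfolding x_def
      by (rule bij_betw_trans[OF bij_enumerate[OF inf_ix]])
        (use inj in \<open>simp add: bij_betw_inv_into inj_on_imp_bij_betw\<close>)
    show "mono (\<lambda>i. f (x i))"
      by (rule monoI, rule le) (auto simp: x_in ix_x inf_ix)
  qed
qed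

section \<open>Choice of parents in a net\<close>

theorem corollary4p4:
  fixes N :: "((real^'n) \<times> real) set" and z :: "(real^'n) \<times> real"
  assumes "CARD('n) \<ge> 2"
    and "is_net hyperbolic_space hyperbolic_dist N"
    and "z \<in> N"
  shows "\<exists>e. schauder_basis (free_space N hyperbolic_dist z)
               (Lip0_dual_norm N hyperbolic_dist z) e"
proof -
  let ?d = "hyperbolic_dist :: (real^'n) \<times> real \<Rightarrow> _"
  obtain a b where NH: "N \<subseteq> hyperbolic_space" and "0 < a" "0 < b"
    and sep: "\<And>x y. x \<in> N \<Longrightarrow> y \<in> N \<Longrightarrow> x \<noteq> y \<Longrightarrow> a \<le> ?d x y"
    and dense: "\<And>x. x \<in> hyperbolic_space \<Longrightarrow> \<exists>y\<in>N. ?d x y \<le> b"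
    using assms(2) unfolding is_net_def by blast
  have zH: "z \<in> hyperbolic_space" using NH assms(3) by blast
  have "finite {y \<in> N. ?d y z \<le> r}" for r
    using finite_separated_hyperbolic_ball[OF NH zH \<open>0 < a\<close> sep] by blast
  then obtain x :: "nat \<Rightarrow> (real^'n) \<times> real"
    where bij: "bij_betw x UNIV N" and mono: "mono (\<lambda>i. ?d (x i) z)"
    by (rule enumerate_by_level[OF infinite_hyperbolic_net[OF assms(2)], of "\<lambda>y. ?d y z"])
  have xN: "x i \<in> N" for i using bij by (auto simp: bij_betw_def)
  have xH: "x i \<in> hyperbolic_space" for i using xN NH by blast
  have surj: "\<exists>i. x i = y" if "y \<in> N" for y using bij that by (auto simp: bij_betw_def)
  have x_inj: "x i = x j \<longleftrightarrow> i = j" for i j using bij by (auto simp: bij_betw_def dest: injD)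
  have x0: "x 0 = z"
  proof -
    obtain k where "x k = z" using surj assms(3) by blast
    then have "?d (x 0) z \<le> 0" using monoD[OF mono, of 0 k] hyperbolic_dist_eq_0_iff[OF zH zH] by simp
    then show ?thesis
      using hyperbolic_dist_nonneg[OF xH zH, of 0] hyperbolic_dist_eq_0_iff[OF xH zH, of 0] by simp
  qed

  define D :: real where "D = ln 16"
  have D: "0 \<le> D" by (simp add: D_def)
  \<comment> \<open>A net point within \<open>b\<close> of the geodesic point \<open>R\<close>
    further back is lower by at least \<open>R - b = D + 1\<close>. This covers the drop
    \<open>D\<close>, and the 1 makes it strict, so the monotone enumeration gives a smaller
    index.\<close>
  define R where "R = b + D + 1"
  have "\<exists>j<i. ?d (x i) z - (R + b) \<le> ?d (x j) z \<and> (j \<noteq> 0 \<longrightarrow> ?d (x j) z \<le> ?d (x i) z - D)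
      \<and> ?d (x i) (x j) \<le> ?d (x i) z - ?d (x j) z + 2 * b" if i: "0 < i" for i
  proof (cases "?d (x i) z < R")
    \<comment> \<open>Close to \<open>z\<close> the root itself is the parent; the path is then
      exactly straight.\<close>
    case True
    then show ?thesis
      using i \<open>0 < b\<close> hyperbolic_dist_eq_0_iff[OF zH zH] by (intro exI[of _ 0]) (simp add: x0)
  next
    case False
    then obtain g where g: "g \<in> hyperbolic_space" "?d (x i) g = R" "?d g z = ?d (x i) z - R"
      using hyperbolic_geodesic_point[OF xH zH, of R i] \<open>0 < b\<close> D by (auto simp: R_def)
    obtain j where j: "?d g (x j) \<le> b" using dense[OF g(1)] surj by metis
    \<comment> \<open>The distance to the parent is at most \<open>R + b\<close> and the height
      drops by at least \<open>R - b\<close>; the discrepancy is the \<open>2 * b\<close> of the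
      straightness condition.\<close>
    have "?d (x i) (x j) \<le> R + b" "?d (x j) z \<le> ?d (x i) z - R + b" "?d (x i) z - R \<le> b + ?d (x j) z"
      using hyperbolic_dist_triangle[OF xH g(1) xH, of i j] hyperbolic_dist_triangle[OF xH g(1) zH, of j]
        hyperbolic_dist_triangle[OF g(1) xH zH, of j] hyperbolic_dist_commute[of g "x j"] g j by auto
    moreover from this(2) have "j < i"
      using monoD[OF mono, of i j] D by (force simp: R_def)
    ultimately show ?thesis using D by (intro exI[of _ j]) (simp add: R_def)
  qed
  then obtain par where par: "\<And>i. 0 < i \<Longrightarrow> par i < i"
    "\<And>i. 0 < i \<Longrightarrow> ?d (x i) z - (R + b) \<le> ?d (x (par i)) z"
    "\<And>i. 0 < i \<Longrightarrow> par i \<noteq> 0 \<Longrightarrow> ?d (x (par i)) z \<le> ?d (x i) z - D"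
    "\<And>i. 0 < i \<Longrightarrow> ?d (x i) (x (par i)) \<le> ?d (x i) z - ?d (x (par i)) z + 2 * b"
    by metis
  have "\<exists>C\<ge>0. \<forall>n i j. ?d (x (ancestor par n i)) (x (ancestor par n j)) \<le> C * ?d (x i) (x j)"
  proof (rule ancestor_Lipschitz[where a = a and D = D and \<beta> = "2 * b" and S = "R + b"])
    show "?d (x i) (x j) + ?d (x k) (x 0)
        \<le> max (?d (x i) (x k) + ?d (x j) (x 0)) (?d (x k) (x j) + ?d (x i) (x 0)) + D" for i j k
      unfolding D_def by (rule hyperbolic_dist_four_point) (rule xH)+
    show "?d (x i) (x j) = ?d (x j) (x i)" for i j by (rule hyperbolic_dist_commute)
    show "?d (x i) (x k) \<le> ?d (x i) (x j) + ?d (x j) (x k)" for i j k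
      by (rule hyperbolic_dist_triangle) (rule xH)+
    show "a \<le> ?d (x i) (x j)" if "i \<noteq> j" for i j
      using that by (intro sep) (auto simp: xN x_inj)
    show "?d (x i) (x 0) \<le> ?d (x j) (x 0)" if "i \<le> j" for i j
      using monoD[OF mono that] by (simp add: x0)
  qed (use par \<open>0 < a\<close> \<open>0 < b\<close> D hyperbolic_dist_nonneg[OF xH xH] hyperbolic_dist_eq_0_iff[OF xH xH]
      in \<open>simp_all add: x0 R_def\<close>)
  then obtain C where C: "0 \<le> C"
    "\<And>n i j. ?d (x (ancestor par n i)) (x (ancestor par n j)) \<le> C * ?d (x i) (x j)"
    by blast
  show ?thesis
    unfolding x0[symmetric]
  proof (rule exI, rule tree_retractions_schauder_basis[where d = ?d, OF bij _ \<open>0 < a\<close> _ _ C])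
    show "0 \<le> ?d u v" if "u \<in> N" "v \<in> N" for u v
      using that NH hyperbolic_dist_nonneg by blast
  qed (use sep par(1) in auto)
qed

end
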